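(* The abstract projection $\pi_{\mathrm{Sh}}$ is correct and complete with respect to the concrete projection $\pi_{\mathrm{Ps}}$: for every $\chi\in\mathtt{Psub}$ and every set of variables $V\subseteq\mathcal V$, $$\alpha_{\mathrm{Sh}}(\pi_{\mathrm{Ps}}(\chi,V))=\pi_{\mathrm{Sh}}(\alpha_{\mathrm{Sh}}(\chi),V).$$
   Context: Fix a first-order signature with at least one constant and one function symbol of arity $\ge 2$, and an infinite set $\mathcal V$ of variables; $\wp_f$ denotes finite subsets. A substitution is a map $\theta$ from $\mathcal V$ to terms with finite $\mathrm{dom}(\theta)=\{x\mid\theta(x)\neq x\}$; $\mathrm{rng}(\theta)$ is the set of variables of the terms $\theta(x)$, $x\in\mathrm{dom}(\theta)$. $\mathit{ISubst}$ is the set of idempotent substitutions ($\mathrm{dom}\cap\mathrm{rng}=\emptyset$); a renaming is a substitution that is a bijection $\mathcal V\to\mathcal V$. For $U\in\wp_f(\mathcal V)$, $\theta_1\sim_U\theta_2$ iff there is a renaming $\rho$ with $\theta_1(u)=\rho(\theta_2(u))$ for all $u\in U$; $[\theta]_U$ is the $\sim_U$-class of $\theta\in\mathit{ISubst}$ and $\mathit{ISubst}_{\sim_U}$ the set of such classes. Concrete domain: $\mathtt{Psub}=\{[\Theta,U]\mid\Theta\subseteq\mathit{ISubst}_{\sim_U},U\in\wp_f(\mathcal V)\}\cup\{\bot_{\mathrm{Ps}},\top_{\mathrm{Ps}}\}$, ordered with bottom $\bot_{\mathrm{Ps}}$, top $\top_{\mathrm{Ps}}$, and $[\Theta_1,U_1]\sqsubseteq_{\mathrm{Ps}}[\Theta_2,U_2]$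 iff $U_1=U_2$, $\Theta_1\subseteq\Theta_2$. Abstract domain: $\mathtt{Sharing}=\{[A,U]\mid A\subseteq\wp(U),(A\ne\emptyset\Rightarrow\emptyset\in A),U\in\wp_f(\mathcal V)\}\cup\{\bot_{\mathrm{Sh}},\top_{\mathrm{Sh}}\}$, ordered in the same way. Abstraction: $\mathrm{occ}(\sigma,y)=\{z\in\mathcal V\mid y\in\mathrm{vars}(\sigma(z))\}$; $\alpha_{\mathrm{Sh}}([\sigma]_V)=[\{\mathrm{occ}(\sigma,y)\cap V\mid y\in\mathcal V\},V]$ (independent of representatives); $\alpha_{\mathrm{Sh}}(\bot_{\mathrm{Ps}})=\bot_{\mathrm{Sh}}$, $\alpha_{\mathrm{Sh}}(\top_{\mathrm{Ps}})=\top_{\mathrm{Sh}}$, and $\alpha_{\mathrm{Sh}}([\Theta,U])=[\bigcup_{[\sigma]_U\in\Theta}A_\sigma,U]$, where $\alpha_{\mathrm{Sh}}([\sigma]_U)=[A_\sigma,U]$ (so $\alpha_{\mathrm{Sh}}([\emptyset,U])=[\emptyset,U]$). Projections: $\pi_{\mathrm{Ps}}([\Theta,U],V)=[\{[\sigma]_{U\cap V}\mid[\sigma]_U\in\Theta\},U\cap V]$, $\pi_{\mathrm{Sh}}([A,U],V)=[\{B\cap V\mid B\in A\},U\cap V]$; both map bottom to bottom and top to top. *)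

theory Defs
  imports Main
begin

section \<open>Terms and substitutions\<close>

text \<open>
  The symbols are the elements of \<^typ>\<open>'f\<close>, with arities given by \<open>ar\<close>; the variables are the
  elements of \<^typ>\<open>'v\<close>.  The datatype also contains terms that violate the arities; these are
  excluded by \<open>wf_trm\<close>.
\<close>

datatype (syms: 'f, vars: 'v) trm = Var 'v | Fn 'f "('f, 'v) trm list"

primrec wf_trm :: "('f \<Rightarrow> nat) \<Rightarrow> ('f, 'v) trm \<Rightarrow> bool" where
  "wf_trm ar (Var x) \<longleftrightarrow> True"
| "wf_trm ar (Fn f ts) \<longleftrightarrow> length ts = ar f \<and> list_all (wf_trm ar) ts"

type_synonym ('f, 'v) subst = "'v \<Rightarrow> ('f, 'v) trm"

primrec apply_subst :: "('f, 'v) subst \<Rightarrow> ('f, 'v) trm \<Rightarrow> ('f, 'v) trm" where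
  "apply_subst \<sigma> (Var x) = \<sigma> x"
| "apply_subst \<sigma> (Fn f ts) = Fn f (map (apply_subst \<sigma>) ts)"

definition sdom :: "('f, 'v) subst \<Rightarrow> 'v set" where
  "sdom \<theta> = {x. \<theta> x \<noteq> Var x}"

definition srng :: "('f, 'v) subst \<Rightarrow> 'v set" where
  "srng \<theta> = (\<Union>x\<in>sdom \<theta>. vars (\<theta> x))"

definition Subst :: "('f \<Rightarrow> nat) \<Rightarrow> ('f, 'v) subst set" where
  "Subst ar = {\<theta>. (\<forall>x. wf_trm ar (\<theta> x)) \<and> finite (sdom \<theta>)}"

definition ISubst :: "('f \<Rightarrow> nat) \<Rightarrow> ('f, 'v) subst set" where
  "ISubst ar = {\<theta> \<in> Subst ar. sdom \<theta> \<inter> srng \<theta> = {}}"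

definition Renaming :: "('f \<Rightarrow> nat) \<Rightarrow> ('f, 'v) subst set" where
  "Renaming ar = {\<rho> \<in> Subst ar. \<exists>p. bij p \<and> \<rho> = (\<lambda>x. Var (p x))}"

text \<open>
  The relation is restricted to idempotent substitutions, so that the classes \<open>[\<theta>]\<^sub>U\<close>
  are exactly the elements of the quotient of \<open>ISubst\<close>.
\<close>

definition sim :: "('f \<Rightarrow> nat) \<Rightarrow> 'v set \<Rightarrow> ('f, 'v) subst rel" where
  "sim ar U = {(\<theta>1, \<theta>2). \<theta>1 \<in> ISubst ar \<and> \<theta>2 \<in> ISubst ar \<and>
     (\<exists>\<rho>\<in>Renaming ar. \<forall>u\<in>U. \<theta>1 u = apply_subst \<rho> (\<theta>2 u))}"

definition cls :: "('f \<Rightarrow> nat) \<Rightarrow> 'v set \<Rightarrow> ('f, 'v) subst \<Rightarrow> ('f, 'v) subst set" where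
  "cls ar U \<theta> = sim ar U `` {\<theta>}"

definition ISubst_sim :: "('f \<Rightarrow> nat) \<Rightarrow> 'v set \<Rightarrow> ('f, 'v) subst set set" where
  "ISubst_sim ar U = ISubst ar // sim ar U"


section \<open>Concrete and abstract domain\<close>

text \<open>
  Both domains consist of a bottom, a top and elements \<open>[S, U]\<close>, ordered in the same way.
  They differ in the type of the members of \<open>S\<close> and in the side conditions on \<open>S\<close>.
\<close>

datatype ('a, 'v) adom = Bottom | Elem "'a set" "'v set" | Top

fun adom_le :: "('a, 'v) adom \<Rightarrow> ('a, 'v) adom \<Rightarrow> bool" where
  "adom_le Bottom y = True"
| "adom_le x Top = True"
| "adom_le (Elem S1 U1) (Elem S2 U2) = (U1 = U2 \<and> S1 \<subseteq> S2)"
| "adom_le (Elem S1 U1) Bottom = False"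
| "adom_le Top Bottom = False"
| "adom_le Top (Elem S2 U2) = False"

type_synonym ('f, 'v) psub = "(('f, 'v) subst set, 'v) adom"
type_synonym 'v sharing = "('v set, 'v) adom"

definition Psub :: "('f \<Rightarrow> nat) \<Rightarrow> ('f, 'v) psub set" where
  "Psub ar = {Elem \<Theta> U | \<Theta> U. \<Theta> \<subseteq> ISubst_sim ar U \<and> finite U} \<union> {Bottom, Top}"

definition Sharing :: "'v sharing set" where
  "Sharing = {Elem A U | A U. A \<subseteq> Pow U \<and> (A \<noteq> {} \<longrightarrow> {} \<in> A) \<and> finite U} \<union> {Bottom, Top}"


section \<open>Abstraction and projections\<close>

definition occ :: "('f, 'v) subst \<Rightarrow> 'v \<Rightarrow> 'v set" where
  "occ \<sigma> y = {z. y \<in> vars (\<sigma> z)}"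

definition sharing_groups :: "'v set \<Rightarrow> ('f, 'v) subst \<Rightarrow> 'v set set" where
  "sharing_groups U \<sigma> = {occ \<sigma> y \<inter> U | y. True}"

text \<open>
  The set \<open>A\<^sub>\<sigma>\<close> as a function of the class \<open>[\<sigma>]\<^sub>U\<close>.  All members of a class have the same
  sharing groups, so the union below is the value at any representative
  (lemmas \<open>sharing_groups_respects\<close> and \<open>class_groups_cls\<close>).
\<close>

definition class_groups :: "'v set \<Rightarrow> ('f, 'v) subst set \<Rightarrow> 'v set set" where
  "class_groups U C = (\<Union>\<sigma>\<in>C. sharing_groups U \<sigma>)"

fun alpha_Sh :: "('f, 'v) psub \<Rightarrow> 'v sharing" where
  "alpha_Sh Bottom = Bottom"
| "alpha_Sh Top = Top"
| "alpha_Sh (Elem \<Theta> U) = Elem (\<Union>C\<in>\<Theta>. class_groups U C) U"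

fun pi_Ps :: "('f \<Rightarrow> nat) \<Rightarrow> ('f, 'v) psub \<Rightarrow> 'v set \<Rightarrow> ('f, 'v) psub" where
  "pi_Ps ar Bottom V = Bottom"
| "pi_Ps ar Top V = Top"
| "pi_Ps ar (Elem \<Theta> U) V =
     Elem {cls ar (U \<inter> V) \<sigma> | \<sigma>. \<sigma> \<in> ISubst ar \<and> cls ar U \<sigma> \<in> \<Theta>} (U \<inter> V)"

fun pi_Sh :: "'v sharing \<Rightarrow> 'v set \<Rightarrow> 'v sharing" where
  "pi_Sh Bottom V = Bottom"
| "pi_Sh Top V = Top"
| "pi_Sh (Elem A U) V = Elem {B \<inter> V | B. B \<in> A} (U \<inter> V)"


section \<open>Well-definedness\<close>

lemma apply_subst_Var: "apply_subst Var t = t"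
  by (induction t) (simp_all add: map_idI)

lemma apply_subst_comp:
  "apply_subst \<sigma> (apply_subst \<tau> t) = apply_subst (\<lambda>x. apply_subst \<sigma> (\<tau> x)) t"
  by (induction t) auto

lemma vars_apply_ren: "vars (apply_subst (\<lambda>x. Var (p x)) t) = p ` vars t"
  by (induction t) auto

lemma finite_vars: "finite (vars t)"
  by (induction t) auto

lemma Renaming_id: "Var \<in> Renaming ar"
  by (auto simp: Renaming_def Subst_def sdom_def intro!: exI[of _ id])

lemma Renaming_comp:
  assumes "\<rho> \<in> Renaming ar" "\<rho>' \<in> Renaming ar"
  shows "(\<lambda>x. apply_subst \<rho> (\<rho>' x)) \<in> Renaming ar"
proof -
  obtain p where p: "bij p" "\<rho> = (\<lambda>x. Var (p x))" "finite {x. p x \<noteq> x}"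
    using assms(1) by (auto simp: Renaming_def Subst_def sdom_def)
  obtain q where q: "bij q" "\<rho>' = (\<lambda>x. Var (q x))" "finite {x. q x \<noteq> x}"
    using assms(2) by (auto simp: Renaming_def Subst_def sdom_def)
  have "{x. p (q x) \<noteq> x} \<subseteq> {x. p x \<noteq> x} \<union> {x. q x \<noteq> x}"
    by auto
  then have "finite {x. p (q x) \<noteq> x}"
    using p(3) q(3) by (meson finite_UnI finite_subset)
  moreover have "bij (\<lambda>x. p (q x))"
    using bij_comp[OF q(1) p(1)] by (simp add: comp_def)
  ultimately show ?thesis
    using p(2) q(2) by (auto simp: Renaming_def Subst_def sdom_def)
qed

lemma Renaming_inverse:
  assumes "\<rho> \<in> Renaming ar"
  obtains \<rho>' where "\<rho>' \<in> Renaming ar" "\<And>t. apply_subst \<rho>' (apply_subst \<rho> t) = t"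
proof -
  obtain p where p: "bij p" "\<rho> = (\<lambda>x. Var (p x))" "finite {x. p x \<noteq> x}"
    using assms by (auto simp: Renaming_def Subst_def sdom_def)
  have "{x. inv p x \<noteq> x} \<subseteq> {x. p x \<noteq> x}"
    using p(1) by (metis (mono_tags, lifting) Collect_mono bij_inv_eq_iff)
  then have "finite {x. inv p x \<noteq> x}"
    using p(3) finite_subset by blast
  then have "(\<lambda>x. Var (inv p x)) \<in> Renaming ar"
    using bij_imp_bij_inv[OF p(1)] by (auto simp: Renaming_def Subst_def sdom_def)
  moreover have "apply_subst (\<lambda>x. Var (inv p x)) (apply_subst \<rho> t) = t" for t
    using p(1) by (simp add: apply_subst_comp p(2) bij_def inv_f_f apply_subst_Var)
  ultimately show thesis
    by (rule that)
qed

lemma equiv_sim: "equiv (ISubst ar) (sim ar U)"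
proof (rule equivI)
  show "sim ar U \<subseteq> ISubst ar \<times> ISubst ar"
    by (auto simp: sim_def)
  show "refl_on (ISubst ar) (sim ar U)"
    using Renaming_id[of ar] by (auto simp: refl_on_def sim_def apply_subst_Var intro!: bexI[of _ Var])
  show "sym (sim ar U)"
  proof (rule symI)
    fix \<theta> \<theta>' assume "(\<theta>, \<theta>') \<in> sim ar U"
    then obtain \<rho> where \<rho>: "\<theta> \<in> ISubst ar" "\<theta>' \<in> ISubst ar" "\<rho> \<in> Renaming ar"
      "\<forall>u\<in>U. \<theta> u = apply_subst \<rho> (\<theta>' u)"
      by (auto simp: sim_def)
    obtain \<rho>' where "\<rho>' \<in> Renaming ar" "\<And>t. apply_subst \<rho>' (apply_subst \<rho> t) = t"
      using Renaming_inverse[OF \<rho>(3)] by metis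
    then show "(\<theta>', \<theta>) \<in> sim ar U"
      using \<rho> by (auto simp: sim_def intro!: bexI[of _ \<rho>'])
  qed
  show "trans (sim ar U)"
  proof (rule transI)
    fix \<theta> \<theta>' \<theta>'' assume "(\<theta>, \<theta>') \<in> sim ar U" "(\<theta>', \<theta>'') \<in> sim ar U"
    then obtain \<rho> \<rho>' where "\<theta> \<in> ISubst ar" "\<theta>'' \<in> ISubst ar"
      "\<rho> \<in> Renaming ar" "\<forall>u\<in>U. \<theta> u = apply_subst \<rho> (\<theta>' u)"
      "\<rho>' \<in> Renaming ar" "\<forall>u\<in>U. \<theta>' u = apply_subst \<rho>' (\<theta>'' u)"
      by (auto simp: sim_def)
    then show "(\<theta>, \<theta>'') \<in> sim ar U"
      using Renaming_comp[of \<rho> ar \<rho>']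
      by (auto simp: sim_def apply_subst_comp intro!: bexI[of _ "\<lambda>x. apply_subst \<rho> (\<rho>' x)"])
  qed
qed

lemma sharing_groups_respects: "sharing_groups U respects sim ar U"
proof (rule congruentI)
  fix \<theta> \<theta>' assume "(\<theta>, \<theta>') \<in> sim ar U"
  then obtain p where p: "bij p" "\<forall>u\<in>U. \<theta> u = apply_subst (\<lambda>x. Var (p x)) (\<theta>' u)"
    by (auto simp: sim_def Renaming_def)
  then have "occ \<theta> (p y) \<inter> U = occ \<theta>' y \<inter> U" for y
    by (auto simp: occ_def vars_apply_ren bij_def inj_image_mem_iff)
  moreover have "sharing_groups U \<theta> = range (\<lambda>y. occ \<theta> (p y) \<inter> U)"
  proof -
    have "sharing_groups U \<theta> = (\<lambda>y. occ \<theta> y \<inter> U) ` range p"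
      using bij_is_surj[OF p(1)] by (auto simp: sharing_groups_def)
    then show ?thesis
      by (simp add: image_image)
  qed
  ultimately show "sharing_groups U \<theta> = sharing_groups U \<theta>'"
    by (auto simp: sharing_groups_def)
qed

lemma class_groups_cls:
  assumes "\<sigma> \<in> ISubst ar"
  shows "class_groups U (cls ar U \<sigma>) = sharing_groups U \<sigma>"
  unfolding class_groups_def cls_def
  by (rule UN_equiv_class[OF equiv_sim sharing_groups_respects assms])

lemma pi_Ps_in_Psub: "\<chi> \<in> Psub ar \<Longrightarrow> pi_Ps ar \<chi> V \<in> Psub ar"
  by (auto simp: Psub_def ISubst_sim_def cls_def intro: quotientI)

lemma pi_Sh_in_Sharing: "a \<in> Sharing \<Longrightarrow> pi_Sh a V \<in> Sharing"
  by (cases a) (fastforce simp: Sharing_def)+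

lemma empty_in_sharing_groups:
  fixes \<sigma> :: "('f, 'v) subst"
  assumes "infinite (UNIV :: 'v set)" "finite U"
  shows "{} \<in> sharing_groups U \<sigma>"
proof -
  have "finite (\<Union>u\<in>U. vars (\<sigma> u))"
    using assms(2) by (simp add: finite_vars)
  then obtain y where "y \<notin> (\<Union>u\<in>U. vars (\<sigma> u))"
    using assms(1) ex_new_if_finite by blast
  then have "{} = occ \<sigma> y \<inter> U"
    by (auto simp: occ_def)
  then show ?thesis
    by (auto simp: sharing_groups_def)
qed

lemma alpha_Sh_in_Sharing:
  fixes \<chi> :: "('f, 'v) psub"
  assumes "infinite (UNIV :: 'v set)" "\<chi> \<in> Psub ar"
  shows "alpha_Sh \<chi> \<in> Sharing"
proof (cases \<chi>)
  case (Elem \<Theta> U)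
  have "finite U"
    using assms(2) Elem by (auto simp: Psub_def)
  have "{} \<in> sharing_groups U \<sigma>" "sharing_groups U \<sigma> \<subseteq> Pow U" for \<sigma> :: "('f, 'v) subst"
    using empty_in_sharing_groups[OF assms(1) \<open>finite U\<close>] by (auto simp: sharing_groups_def)
  then show ?thesis
    using Elem \<open>finite U\<close> by (fastforce simp: Sharing_def class_groups_def)
qed (auto simp: Sharing_def)

end

theory Submission
  imports Defs
begin

text \<open>Restricting a sharing group \<open>occ \<sigma> y \<inter> U\<close> to \<open>V\<close>
  gives the group of the same \<open>y\<close> over \<open>U \<inter> V\<close>
  (\<open>sharing_groups_Int\<close>). The groups of a class can be read off any representative
  (\<open>class_groups_cls\<close>), so both sides are unions over the same substitutions, and
  intersecting with \<open>V\<close> commutes with unions.\<close>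

lemma sharing_groups_Int: "sharing_groups (U \<inter> V) \<sigma> = (\<lambda>B. B \<inter> V) ` sharing_groups U \<sigma>"
  by (simp add: sharing_groups_def full_SetCompr_eq image_image Int_assoc)

theorem theorem5p3:
  fixes ar :: "'f \<Rightarrow> nat" and \<chi> :: "('f, 'v) psub" and V :: "'v set"
  assumes "infinite (UNIV :: 'v set)"
    and "\<exists>c. ar c = 0"
    and "\<exists>f. ar f \<ge> 2"
    and "\<chi> \<in> Psub ar"
  shows "alpha_Sh (pi_Ps ar \<chi> V) = pi_Sh (alpha_Sh \<chi>) V"
proof (cases \<chi>)
  case (Elem \<Theta> U)
  \<comment> \<open>All representatives of classes in \<open>\<Theta>\<close>: projection coarsens
    the equivalence but keeps these substitutions, so \<open>R\<close> indexes both sides.\<close>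
  define R where "R = {\<sigma> \<in> ISubst ar. cls ar U \<sigma> \<in> \<Theta>}"
  have "\<Theta> \<subseteq> ISubst_sim ar U"
    using assms(4) Elem by (auto simp: Psub_def)
  \<comment> \<open>Membership in \<open>Psub\<close> ensures that every element of
    \<open>\<Theta>\<close> is a class and so has a representative in \<open>R\<close>.\<close>
  then have \<Theta>: "cls ar U ` R = \<Theta>"
    by (force simp: R_def ISubst_sim_def cls_def elim!: quotientE)
  \<comment> \<open>Needed for \<open>W = U \<inter> V\<close> on the concrete side and for
    \<open>W = U\<close> on the abstract side.\<close>
  have groups: "(\<Union>C\<in>cls ar W ` R. class_groups W C) = (\<Union>\<sigma>\<in>R. sharing_groups W \<sigma>)" for W
    unfolding image_image by (rule SUP_cong) (simp_all add: R_def class_groups_cls)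
  have "{cls ar (U \<inter> V) \<sigma> | \<sigma>. \<sigma> \<in> ISubst ar \<and> cls ar U \<sigma> \<in> \<Theta>} = cls ar (U \<inter> V) ` R"
    unfolding R_def by blast
  then have "alpha_Sh (pi_Ps ar \<chi> V) = Elem (\<Union>\<sigma>\<in>R. sharing_groups (U \<inter> V) \<sigma>) (U \<inter> V)"
    unfolding Elem pi_Ps.simps alpha_Sh.simps using groups[of "U \<inter> V"] by metis
  also have "\<dots> = pi_Sh (Elem (\<Union>\<sigma>\<in>R. sharing_groups U \<sigma>) U) V"
    unfolding sharing_groups_Int pi_Sh.simps by blast
  also have "\<dots> = pi_Sh (alpha_Sh \<chi>) V"
    unfolding Elem alpha_Sh.simps groups[of U, unfolded \<Theta>] ..
  finally show ?thesis .
qed simp_all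

end
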